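(* Let $L$ be a bounded distributive lattice and $\mathcal{W}$ its ordered space of weakly prime pairs. There is an order-homeomorphism $\Lambda:P(L^{\Diamond\Box})\to\mathcal{W}$ given by $\Lambda(G)=(F,I)$ where $F=\{a\mid \Box_a\in G\}$ and $I=\{a\mid \Diamond_a\notin G\}$. Further, for each $a\in L$ we have $\Lambda(\Box_a^+)=\Box_a^\uparrow$, $\Lambda(\Box_a^-)=\Box_a^\downarrow$, $\Lambda(\Diamond_a^+)=\Diamond_a^\uparrow$ and $\Lambda(\Diamond_a^-)=\Diamond_a^\downarrow$.
   Context: For a bounded distributive lattice $D$, its Priestley space $P(D)$ is the set of (proper) prime filters of $D$ ordered by inclusion, with the topology generated by the sets $d^+=\{G\in P(D)\mid d\in G\}$ and $d^-=\{G\in P(D)\mid d\notin G\}$, $d\in D$. Here $\Box_a^{\pm}=(\Box_a)^{\pm}$ and $\Diamond_a^{\pm}=(\Diamond_a)^{\pm}$ are subsets of $P(L^{\Diamond\Box})$. $L^{\Diamond\Box}$ is the bounded distributive lattice freely generated by the set of symbols $\Diamond_a,\Box_a$ for $a\in L$ modulo the relations (for all $a,b\in L$): $\Diamond_0=0$, $\Diamond_a\vee\Diamond_b=\Diamond_{a\vee b}$, $\Box_1=1$, $\Box_a\wedge\Box_b=\Box_{a\wedge b}$, $\Box_{a\vee b}\le\Box_a\vee\Diamond_b$, and $\Box_a\wedge\Diamond_b\le\Diamond_{a\wedge b}$. A weakly prime pair $(F,I)$ of $L$ consists of a filter $F$ and an ideal $I$ of $L$ (both nonempty, possibly improper) such that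 for all $a,b\in L$: $a\vee b\in F$ implies $a\in F$ or $b\notin I$; and $a\wedge b\in I$ implies $a\notin F$ or $b\in I$. $\mathcal{W}$ is the set of weakly prime pairs of $L$, partially ordered by $(F,I)\leq(F',I')$ iff $F\subseteq F'$ and $I'\subseteq I$, with the topology having as a subbasis, for all $a\in L$, the sets $\Box_a^\uparrow=\{(F,I)\mid a\in F\}$, $\Box_a^\downarrow=\{(F,I)\mid a\notin F\}$, $\Diamond_a^\uparrow=\{(F,I)\mid a\notin I\}$, $\Diamond_a^\downarrow=\{(F,I)\mid a\in I\}$. An order-homeomorphism is a homeomorphism that is an order-isomorphism. *)

theory Defs
  imports "HOL-Analysis.Analysis"
begin

section \<open>The lattice generated by the symbols $\Diamond_a$ and $\Box_a$\<close>

datatype 'a mterm =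
    DiaT 'a
  | BoxT 'a
  | ZeroT
  | OneT
  | JoinT "'a mterm" "'a mterm"
  | MeetT "'a mterm" "'a mterm"

text \<open>
  The least congruence on the term algebra containing the equational axioms of bounded
  distributive lattices and the defining relations. A relation \<open>s \<le> t\<close> is encoded as the
  equation \<open>s \<and> t = s\<close>.
\<close>

inductive mcong :: "'a::{bounded_lattice,distrib_lattice} mterm \<Rightarrow> 'a mterm \<Rightarrow> bool" where
  refl: "mcong s s"
| sym: "mcong s t \<Longrightarrow> mcong t s"
| trans: "mcong s t \<Longrightarrow> mcong t u \<Longrightarrow> mcong s u"
| join_cong: "mcong s s' \<Longrightarrow> mcong t t' \<Longrightarrow> mcong (JoinT s t) (JoinT s' t')"
| meet_cong: "mcong s s' \<Longrightarrow> mcong t t' \<Longrightarrow> mcong (MeetT s t) (MeetT s' t')"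
| join_assoc: "mcong (JoinT (JoinT s t) u) (JoinT s (JoinT t u))"
| meet_assoc: "mcong (MeetT (MeetT s t) u) (MeetT s (MeetT t u))"
| join_commute: "mcong (JoinT s t) (JoinT t s)"
| meet_commute: "mcong (MeetT s t) (MeetT t s)"
| join_absorb: "mcong (JoinT s (MeetT s t)) s"
| meet_absorb: "mcong (MeetT s (JoinT s t)) s"
| join_distrib: "mcong (JoinT s (MeetT t u)) (MeetT (JoinT s t) (JoinT s u))"
| join_zero: "mcong (JoinT s ZeroT) s"
| meet_one: "mcong (MeetT s OneT) s"
| dia_bot: "mcong (DiaT bot) ZeroT"
| dia_sup: "mcong (JoinT (DiaT a) (DiaT b)) (DiaT (sup a b))"
| box_top: "mcong (BoxT top) OneT"
| box_inf: "mcong (MeetT (BoxT a) (BoxT b)) (BoxT (inf a b))"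
| box_sup_le: "mcong (MeetT (BoxT (sup a b)) (JoinT (BoxT a) (DiaT b))) (BoxT (sup a b))"
| box_dia_le: "mcong (MeetT (MeetT (BoxT a) (DiaT b)) (DiaT (inf a b))) (MeetT (BoxT a) (DiaT b))"

lemma equivp_mcong: "equivp (mcong :: 'a::{bounded_lattice,distrib_lattice} mterm \<Rightarrow> _)"
  by (rule equivpI) (auto simp: reflp_def symp_def transp_def intro: mcong.refl mcong.sym mcong.trans)

quotient_type (overloaded) 'a modal_lattice =
  "'a::{bounded_lattice,distrib_lattice} mterm" / mcong
  by (rule equivp_mcong)

lift_definition Dia :: "'a::{bounded_lattice,distrib_lattice} \<Rightarrow> 'a modal_lattice" is DiaT .
lift_definition Box :: "'a::{bounded_lattice,distrib_lattice} \<Rightarrow> 'a modal_lattice" is BoxT .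

instantiation modal_lattice :: ("{bounded_lattice,distrib_lattice}") "{bounded_lattice,distrib_lattice}"
begin

lift_definition bot_modal_lattice :: "'a modal_lattice" is ZeroT .
lift_definition top_modal_lattice :: "'a modal_lattice" is OneT .
lift_definition sup_modal_lattice :: "'a modal_lattice \<Rightarrow> 'a modal_lattice \<Rightarrow> 'a modal_lattice"
  is JoinT by (rule mcong.join_cong)
lift_definition inf_modal_lattice :: "'a modal_lattice \<Rightarrow> 'a modal_lattice \<Rightarrow> 'a modal_lattice"
  is MeetT by (rule mcong.meet_cong)
definition less_eq_modal_lattice :: "'a modal_lattice \<Rightarrow> 'a modal_lattice \<Rightarrow> bool"
  where "x \<le> y \<longleftrightarrow> inf x y = (x :: 'a modal_lattice)"
definition less_modal_lattice :: "'a modal_lattice \<Rightarrow> 'a modal_lattice \<Rightarrow> bool"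
  where "x < y \<longleftrightarrow> x \<le> y \<and> \<not> y \<le> (x :: 'a modal_lattice)"

instance
proof
  fix x y z :: "'a modal_lattice"
  have sassoc: "sup (sup x y) z = sup x (sup y z)" for x y z :: "'a modal_lattice"
    by transfer (rule mcong.join_assoc)
  have iassoc: "inf (inf x y) z = inf x (inf y z)" for x y z :: "'a modal_lattice"
    by transfer (rule mcong.meet_assoc)
  have scomm: "sup x y = sup y x" for x y :: "'a modal_lattice"
    by transfer (rule mcong.join_commute)
  have icomm: "inf x y = inf y x" for x y :: "'a modal_lattice"
    by transfer (rule mcong.meet_commute)
  have sabs: "sup x (inf x y) = x" for x y :: "'a modal_lattice"
    by transfer (rule mcong.join_absorb)
  have iabs: "inf x (sup x y) = x" for x y :: "'a modal_lattice"
    by transfer (rule mcong.meet_absorb)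
  have sbot: "sup x bot = x" for x :: "'a modal_lattice"
    by transfer (rule mcong.join_zero)
  have itop: "inf x top = x" for x :: "'a modal_lattice"
    by transfer (rule mcong.meet_one)
  have iidem: "inf x x = x" for x :: "'a modal_lattice"
    using iabs[of x "inf x x"] by (simp only: sabs)
  have le_sup: "x \<le> y \<longleftrightarrow> sup x y = y" for x y :: "'a modal_lattice"
    unfolding less_eq_modal_lattice_def
    using sabs[of y x] iabs[of x y] by (auto simp: scomm icomm)
  show "(x < y) = (x \<le> y \<and> \<not> y \<le> x)"
    by (rule less_modal_lattice_def)
  show "x \<le> x"
    unfolding less_eq_modal_lattice_def by (rule iidem)
  show "x \<le> y \<Longrightarrow> y \<le> z \<Longrightarrow> x \<le> z"
    unfolding less_eq_modal_lattice_def by (metis iassoc)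
  show "x \<le> y \<Longrightarrow> y \<le> x \<Longrightarrow> x = y"
    unfolding less_eq_modal_lattice_def by (metis icomm)
  show "inf x y \<le> x"
    unfolding less_eq_modal_lattice_def by (simp only: icomm[of x y] iassoc iidem)
  show "inf x y \<le> y"
    unfolding less_eq_modal_lattice_def by (simp only: iassoc iidem)
  show "x \<le> y \<Longrightarrow> x \<le> z \<Longrightarrow> x \<le> inf y z"
    unfolding less_eq_modal_lattice_def by (simp flip: iassoc)
  show "x \<le> sup x y"
    unfolding less_eq_modal_lattice_def by (rule iabs)
  show "y \<le> sup x y"
    unfolding less_eq_modal_lattice_def scomm[of x y] by (rule iabs)
  show "y \<le> x \<Longrightarrow> z \<le> x \<Longrightarrow> sup y z \<le> x"
    unfolding le_sup by (simp add: sassoc)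
  show "bot \<le> x"
    unfolding le_sup scomm[of bot x] by (rule sbot)
  show "x \<le> top"
    unfolding less_eq_modal_lattice_def by (rule itop)
  show "sup x (inf y z) = inf (sup x y) (sup x z)"
    by transfer (rule mcong.join_distrib)
qed

end

lemma modal_lattice_relations:
  fixes a b :: "'a::{bounded_lattice,distrib_lattice}"
  shows "Dia (bot::'a) = bot" and "sup (Dia a) (Dia b) = Dia (sup a b)"
    and "Box (top::'a) = top" and "inf (Box a) (Box b) = Box (inf a b)"
    and "Box (sup a b) \<le> sup (Box a) (Dia b)" and "inf (Box a) (Dia b) \<le> Dia (inf a b)"
  unfolding less_eq_modal_lattice_def by (transfer, rule mcong.dia_bot mcong.dia_sup mcong.box_top mcong.box_inf
    mcong.box_sup_le mcong.box_dia_le)+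

lemma modal_lattice_induct:
  fixes x :: "'a::{bounded_lattice,distrib_lattice} modal_lattice"
  assumes "\<And>a. P (Dia a)" "\<And>a. P (Box a)" "P bot" "P top"
    and "\<And>x y. P x \<Longrightarrow> P y \<Longrightarrow> P (sup x y)" "\<And>x y. P x \<Longrightarrow> P y \<Longrightarrow> P (inf x y)"
  shows "P x"
proof (induction x rule: modal_lattice.abs_induct)
  case (1 t)
  show ?case
    by (induction t)
      (use assms in \<open>simp_all flip: Dia.abs_eq Box.abs_eq bot_modal_lattice.abs_eq
         top_modal_lattice.abs_eq sup_modal_lattice.abs_eq inf_modal_lattice.abs_eq\<close>)
qed

definition is_bounded_lattice_hom ::
    "('a::bounded_lattice \<Rightarrow> 'b::bounded_lattice) \<Rightarrow> bool" where
  "is_bounded_lattice_hom h \<longleftrightarrow> h bot = bot \<and> h top = top \<and>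
     (\<forall>x y. h (sup x y) = sup (h x) (h y)) \<and> (\<forall>x y. h (inf x y) = inf (h x) (h y))"

primrec mterm_eval :: "('a \<Rightarrow> 'b) \<Rightarrow> ('a \<Rightarrow> 'b) \<Rightarrow> 'a mterm \<Rightarrow> 'b::bounded_lattice" where
  "mterm_eval d e (DiaT a) = d a"
| "mterm_eval d e (BoxT a) = e a"
| "mterm_eval d e ZeroT = bot"
| "mterm_eval d e OneT = top"
| "mterm_eval d e (JoinT s t) = sup (mterm_eval d e s) (mterm_eval d e t)"
| "mterm_eval d e (MeetT s t) = inf (mterm_eval d e s) (mterm_eval d e t)"

text \<open>The universal property of the presentation.\<close>

theorem modal_lattice_universal:
  fixes d e :: "'a::{bounded_lattice,distrib_lattice} \<Rightarrow> 'b::{bounded_lattice,distrib_lattice}"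
  assumes "d bot = bot" "\<And>a b. sup (d a) (d b) = d (sup a b)"
    and "e top = top" "\<And>a b. inf (e a) (e b) = e (inf a b)"
    and "\<And>a b. e (sup a b) \<le> sup (e a) (d b)" "\<And>a b. inf (e a) (d b) \<le> d (inf a b)"
  shows "\<exists>!h. is_bounded_lattice_hom h \<and> (\<forall>a. h (Dia a) = d a) \<and> (\<forall>a. h (Box a) = e a)"
proof (rule ex_ex1I)
  have sound: "mterm_eval d e s = mterm_eval d e t" if "mcong s t" for s t
    using that
  proof induction
    case (join_assoc s t u)
    show ?case by (simp only: mterm_eval.simps sup_assoc)
  next
    case (meet_assoc s t u)
    show ?case by (simp only: mterm_eval.simps inf_assoc)
  next
    case (join_commute s t)
    show ?case by (simp only: mterm_eval.simps sup_commute)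
  next
    case (meet_commute s t)
    show ?case by (simp only: mterm_eval.simps inf_commute)
  next
    case (join_distrib s t u)
    show ?case by (simp only: mterm_eval.simps sup_inf_distrib1)
  next
    case (box_sup_le a b)
    show ?case using assms(5)[of a b] by (simp add: inf_absorb1)
  next
    case (box_dia_le a b)
    show ?case using assms(6)[of a b] by (simp add: inf_absorb1)
  qed (simp_all add: assms(1-4))
  define h where "h x = mterm_eval d e (rep_modal_lattice x)" for x
  have h_abs: "h (abs_modal_lattice t) = mterm_eval d e t" for t
    unfolding h_def
    by (rule sound) (rule Quotient3_rep_abs[OF Quotient3_modal_lattice mcong.refl])
  have hom: "h (sup x y) = sup (h x) (h y)" "h (inf x y) = inf (h x) (h y)" for x y
    by (induction x rule: modal_lattice.abs_induct; induction y rule: modal_lattice.abs_induct;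
        simp add: sup_modal_lattice.abs_eq inf_modal_lattice.abs_eq h_abs)+
  have "is_bounded_lattice_hom h"
    unfolding is_bounded_lattice_hom_def
    by (simp add: hom) (simp add: bot_modal_lattice.abs_eq top_modal_lattice.abs_eq h_abs)
  then show "\<exists>h. is_bounded_lattice_hom h \<and> (\<forall>a. h (Dia a) = d a) \<and> (\<forall>a. h (Box a) = e a)"
    by (intro exI[of _ h]) (simp add: Dia.abs_eq Box.abs_eq h_abs)
next
  fix h k
  assume h: "is_bounded_lattice_hom h \<and> (\<forall>a. h (Dia a) = d a) \<and> (\<forall>a. h (Box a) = e a)"
    and k: "is_bounded_lattice_hom k \<and> (\<forall>a. k (Dia a) = d a) \<and> (\<forall>a. k (Box a) = e a)"
  have "h x = k x" for x
    by (induction x rule: modal_lattice_induct)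
      (use h k in \<open>simp_all add: is_bounded_lattice_hom_def\<close>)
  then show "h = k" ..
qed

section \<open>Filters, ideals and the Priestley space\<close>

definition is_filter :: "'a::lattice set \<Rightarrow> bool" where
  "is_filter F \<longleftrightarrow> F \<noteq> {} \<and> (\<forall>a b. a \<in> F \<longrightarrow> a \<le> b \<longrightarrow> b \<in> F) \<and>
     (\<forall>a\<in>F. \<forall>b\<in>F. inf a b \<in> F)"

definition is_ideal :: "'a::lattice set \<Rightarrow> bool" where
  "is_ideal I \<longleftrightarrow> I \<noteq> {} \<and> (\<forall>a b. b \<in> I \<longrightarrow> a \<le> b \<longrightarrow> a \<in> I) \<and>
     (\<forall>a\<in>I. \<forall>b\<in>I. sup a b \<in> I)"

definition prime_filters :: "'a::lattice set set" where
  "prime_filters = {G. is_filter G \<and> G \<noteq> UNIV \<and> (\<forall>a b. sup a b \<in> G \<longrightarrow> a \<in> G \<or> b \<in> G)}"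

definition pplus :: "'a::lattice \<Rightarrow> 'a set set" where
  "pplus d = {G \<in> prime_filters. d \<in> G}"

definition pminus :: "'a::lattice \<Rightarrow> 'a set set" where
  "pminus d = {G \<in> prime_filters. d \<notin> G}"

definition priestley_topology :: "'a::lattice set topology" where
  "priestley_topology = topology_generated_by (range pplus \<union> range pminus)"

lemma topspace_priestley_topology: "topspace priestley_topology = prime_filters"
  unfolding priestley_topology_def topology_generated_by_topspace
  by (auto simp: pplus_def pminus_def)

section \<open>The ordered space of weakly prime pairs\<close>

definition weakly_prime_pairs :: "('a::lattice set \<times> 'a set) set" where
  "weakly_prime_pairs = {(F, I). is_filter F \<and> is_ideal I \<and>
     (\<forall>a b. sup a b \<in> F \<longrightarrow> a \<in> F \<or> b \<notin> I) \<and>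
     (\<forall>a b. inf a b \<in> I \<longrightarrow> a \<notin> F \<or> b \<in> I)}"

definition wpp_le :: "'a set \<times> 'a set \<Rightarrow> 'a set \<times> 'a set \<Rightarrow> bool" where
  "wpp_le = (\<lambda>(F, I) (F', I'). F \<subseteq> F' \<and> I' \<subseteq> I)"

definition box_up :: "'a::lattice \<Rightarrow> ('a set \<times> 'a set) set" where
  "box_up a = {(F, I) \<in> weakly_prime_pairs. a \<in> F}"

definition box_down :: "'a::lattice \<Rightarrow> ('a set \<times> 'a set) set" where
  "box_down a = {(F, I) \<in> weakly_prime_pairs. a \<notin> F}"

definition dia_up :: "'a::lattice \<Rightarrow> ('a set \<times> 'a set) set" where
  "dia_up a = {(F, I) \<in> weakly_prime_pairs. a \<notin> I}"

definition dia_down :: "'a::lattice \<Rightarrow> ('a set \<times> 'a set) set" where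
  "dia_down a = {(F, I) \<in> weakly_prime_pairs. a \<in> I}"

definition wpp_topology :: "('a::lattice set \<times> 'a set) topology" where
  "wpp_topology =
     topology_generated_by (range box_up \<union> range box_down \<union> range dia_up \<union> range dia_down)"

lemma topspace_wpp_topology: "topspace wpp_topology = weakly_prime_pairs"
  unfolding wpp_topology_def topology_generated_by_topspace
  by (auto simp: box_up_def box_down_def dia_up_def dia_down_def)

definition order_isomorphism_on ::
    "'p set \<Rightarrow> ('p \<Rightarrow> 'p \<Rightarrow> bool) \<Rightarrow> 'q set \<Rightarrow> ('q \<Rightarrow> 'q \<Rightarrow> bool) \<Rightarrow> ('p \<Rightarrow> 'q) \<Rightarrow> bool" where
  "order_isomorphism_on A le B le' f \<longleftrightarrow>
     bij_betw f A B \<and> (\<forall>x\<in>A. \<forall>y\<in>A. le x y \<longleftrightarrow> le' (f x) (f y))"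

definition order_homeomorphism ::
    "'p topology \<Rightarrow> ('p \<Rightarrow> 'p \<Rightarrow> bool) \<Rightarrow> 'q topology \<Rightarrow> ('q \<Rightarrow> 'q \<Rightarrow> bool) \<Rightarrow> ('p \<Rightarrow> 'q) \<Rightarrow> bool" where
  "order_homeomorphism X le Y le' f \<longleftrightarrow>
     homeomorphic_map X Y f \<and> order_isomorphism_on (topspace X) le (topspace Y) le' f"

end

(* A prime filter G of the modal lattice is a homomorphism to the two-element lattice, so by the
   universal property it amounts to the two predicates "Box a in G" and "Dia a in G"; the defining
   relations then say exactly that ({a. Box a in G}, {a. Dia a notin G}) is a weakly prime pair.
   Since every element of the modal lattice is a lattice polynomial, hence a monotone expression, in
   the generators, inclusion of prime filters is detected on generators, and the subbasic sets d^+
   and d^- are finite combinations of those belonging to generators. *)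

theory Submission
  imports Defs
begin

text \<open>By upward closure, a filter containing \<open>bot\<close> would be all of
  \<open>UNIV\<close>, contradicting properness.\<close>

lemma prime_filter_bot: "bot \<notin> G"
  if "G \<in> prime_filters" for G :: "'a::bounded_lattice set"
  using that unfolding prime_filters_def is_filter_def by (auto 4 3)

lemma prime_filter_top: "top \<in> G"
  if "G \<in> prime_filters" for G :: "'a::bounded_lattice set"
  using that top_greatest unfolding prime_filters_def is_filter_def by blast

lemma prime_filter_mono: "y \<in> G"
  if "G \<in> prime_filters" "x \<in> G" "x \<le> y"
  using that unfolding prime_filters_def is_filter_def by blast

text \<open>Primeness gives one direction and upward closure the other. With the facts on
  \<open>bot\<close>, \<open>top\<close> and \<open>inf\<close>, membership in \<open>G\<close>
  becomes a bounded lattice homomorphism to \<open>bool\<close>.\<close>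

lemma prime_filter_sup_iff: "sup x y \<in> G \<longleftrightarrow> x \<in> G \<or> y \<in> G"
  if "G \<in> prime_filters"
proof
  show "sup x y \<in> G \<Longrightarrow> x \<in> G \<or> y \<in> G"
    using that unfolding prime_filters_def by blast
  show "x \<in> G \<or> y \<in> G \<Longrightarrow> sup x y \<in> G"
    using prime_filter_mono[OF that _ sup_ge1] prime_filter_mono[OF that _ sup_ge2] by blast
qed

lemma prime_filter_inf_iff: "inf x y \<in> G \<longleftrightarrow> x \<in> G \<and> y \<in> G"
  if "G \<in> prime_filters"
proof
  show "inf x y \<in> G \<Longrightarrow> x \<in> G \<and> y \<in> G"
    using prime_filter_mono[OF that _ inf_le1] prime_filter_mono[OF that _ inf_le2] by blast
  show "x \<in> G \<and> y \<in> G \<Longrightarrow> inf x y \<in> G"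
    using that unfolding prime_filters_def is_filter_def by blast
qed

lemma pplus_bot: "pplus (bot :: 'a::bounded_lattice) = {}"
  and pplus_top: "pplus (top :: 'a::bounded_lattice) = prime_filters"
  and pminus_bot: "pminus (bot :: 'a::bounded_lattice) = prime_filters"
  and pminus_top: "pminus (top :: 'a::bounded_lattice) = {}"
  by (auto simp: pplus_def pminus_def prime_filter_bot prime_filter_top)

lemma pplus_sup: "pplus (sup x y) = pplus x \<union> pplus y"
  and pplus_inf: "pplus (inf x y) = pplus x \<inter> pplus y"
  and pminus_sup: "pminus (sup x y) = pminus x \<inter> pminus y"
  and pminus_inf: "pminus (inf x y) = pminus x \<union> pminus y"
  by (auto simp: pplus_def pminus_def prime_filter_sup_iff prime_filter_inf_iff)

lemma openin_pplus: "openin priestley_topology (pplus d)"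
  and openin_pminus: "openin priestley_topology (pminus d)"
  unfolding priestley_topology_def by (auto intro: topology_generated_by_Basis)

lemma openin_wpp:
  "openin wpp_topology (box_up a)" "openin wpp_topology (box_down a)"
  "openin wpp_topology (dia_up a)" "openin wpp_topology (dia_down a)"
  unfolding wpp_topology_def by (auto intro: topology_generated_by_Basis)

text \<open>Builds prime filters from homomorphisms, as surjectivity requires. In
  \<open>bool\<close>, \<open>sup\<close> is disjunction, which yields primeness;
  \<open>h bot\<close> being false yields properness.\<close>

lemma prime_filter_of_bool_hom: "{x. h x} \<in> prime_filters"
  if "is_bounded_lattice_hom h" for h :: "'a::bounded_lattice \<Rightarrow> bool"
proof -
  have bot: "\<not> h bot" and top: "h top"
    and sup: "h (sup x y) \<longleftrightarrow> h x \<or> h y" and inf: "h (inf x y) \<longleftrightarrow> h x \<and> h y" for x y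
    using that by (simp_all add: is_bounded_lattice_hom_def)
  have mono: "h y" if "h x" "x \<le> y" for x y
    using that inf[of x y] by (simp add: inf_absorb1)
  show ?thesis
    unfolding prime_filters_def is_filter_def using bot top mono by (auto simp: sup inf)
qed

definition weakly_prime_pair_of ::
    "'a::{bounded_lattice,distrib_lattice} modal_lattice set \<Rightarrow> 'a set \<times> 'a set" where
  "weakly_prime_pair_of G = ({a. Box a \<in> G}, {a. Dia a \<notin> G})"

lemma Box_mono: "Box a \<le> Box b" if "a \<le> b"
  by (metis inf.absorb1 inf.cobounded2 modal_lattice_relations(4) that)

lemma Dia_mono: "Dia a \<le> Dia b" if "a \<le> b"
  by (metis sup.absorb2 sup.cobounded1 modal_lattice_relations(2) that)

text \<open>The relations on \<open>Box\<close> alone give the filter, those on \<open>Dia\<close>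
  alone give the ideal, and the two mixed relations give the two weak primeness conditions.\<close>

lemma weakly_prime_pair_of_mem:
  assumes G: "G \<in> prime_filters"
  shows "weakly_prime_pair_of G \<in> weakly_prime_pairs"
proof -
  note mono = prime_filter_mono[OF G]
    and sup = prime_filter_sup_iff[OF G] and inf = prime_filter_inf_iff[OF G]
  have "is_filter {a. Box a \<in> G}"
    unfolding is_filter_def
    using mono[OF _ Box_mono] prime_filter_top[OF G]
    by (auto simp: inf modal_lattice_relations(3) simp flip: modal_lattice_relations(4)
        intro!: exI[of _ top])
  moreover have "is_ideal {a. Dia a \<notin> G}"
    unfolding is_ideal_def
    using mono[OF _ Dia_mono] prime_filter_bot[OF G]
    by (auto simp: sup modal_lattice_relations(1) simp flip: modal_lattice_relations(2)
        intro!: exI[of _ bot])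
  moreover have "Box a \<in> G \<or> Dia b \<in> G" if "Box (Lattices.sup a b) \<in> G" for a b
    using mono[OF that modal_lattice_relations(5)] by (simp add: sup)
  moreover have "Dia (Lattices.inf a b) \<in> G" if "Box a \<in> G" "Dia b \<in> G" for a b
    using mono[OF _ modal_lattice_relations(6)] that by (simp add: inf)
  ultimately show ?thesis
    unfolding weakly_prime_pairs_def weakly_prime_pair_of_def by blast
qed

text \<open>The universal property turns a pair into a homomorphism to \<open>bool\<close>, whose
  true set is the required prime filter.\<close>

lemma weakly_prime_pair_of_surj:
  assumes "p \<in> weakly_prime_pairs"
  shows "\<exists>G\<in>prime_filters. weakly_prime_pair_of G = p"
proof -
  obtain F I where p: "p = (F, I)" by fastforce
  have F: "is_filter F" and I: "is_ideal I"
    and FI: "\<And>a b. sup a b \<in> F \<Longrightarrow> a \<in> F \<or> b \<notin> I"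
      "\<And>a b. inf a b \<in> I \<Longrightarrow> a \<notin> F \<or> b \<in> I"
    using assms unfolding p weakly_prime_pairs_def by auto
  have inf: "inf a b \<in> F \<longleftrightarrow> a \<in> F \<and> b \<in> F" for a b
    using F unfolding is_filter_def by (meson inf_le1 inf_le2)
  have sup: "sup a b \<in> I \<longleftrightarrow> a \<in> I \<and> b \<in> I" for a b
    using I unfolding is_ideal_def by (meson sup_ge1 sup_ge2)
  have top: "top \<in> F"
    using F top_greatest unfolding is_filter_def by blast
  have bot: "bot \<in> I"
    using I bot_least unfolding is_ideal_def by blast
  obtain h :: "'a modal_lattice \<Rightarrow> bool" where h: "is_bounded_lattice_hom h"
    "\<And>a. h (Dia a) \<longleftrightarrow> a \<notin> I" "\<And>a. h (Box a) \<longleftrightarrow> a \<in> F"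
  proof -
    \<comment> \<open>Here \<open>d a\<close> is \<open>a \<notin> I\<close> and \<open>e a\<close>
      is \<open>a \<in> F\<close>. As \<le> on \<open>bool\<close> is implication, the mixed
      inequalities are the conditions \<open>FI\<close>.\<close>
    have "\<exists>!h. is_bounded_lattice_hom h \<and> (\<forall>a. h (Dia a) = (a \<notin> I)) \<and>
        (\<forall>a. h (Box a) = (a \<in> F))"
    proof (rule modal_lattice_universal)
      show "(sup a b \<in> F) \<le> sup (a \<in> F) (b \<notin> I)" for a b
        using FI(1)[of a b] by simp
      show "inf (a \<in> F) (b \<notin> I) \<le> (inf a b \<notin> I)" for a b
        using FI(2)[of a b] by auto
    qed (simp_all add: inf sup top bot)
    with that show thesis by blast
  qed
  have "weakly_prime_pair_of {x. h x} = p"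
    unfolding weakly_prime_pair_of_def p by (simp add: h)
  with prime_filter_of_bool_hom[OF h(1)] show ?thesis by blast
qed

lemma image_weakly_prime_pair_of: "weakly_prime_pair_of ` prime_filters = weakly_prime_pairs"
  using weakly_prime_pair_of_mem weakly_prime_pair_of_surj by blast

text \<open>For the forward direction, induct on lattice elements: the hypothesis settles the
  generators, the reversed inclusion of ideals becoming a forward one for \<open>Dia\<close>, and
  primeness carries membership through \<open>sup\<close> and \<open>inf\<close>.\<close>

lemma weakly_prime_pair_of_le_iff:
  assumes G: "G \<in> prime_filters" and H: "H \<in> prime_filters"
  shows "wpp_le (weakly_prime_pair_of G) (weakly_prime_pair_of H) \<longleftrightarrow> G \<subseteq> H"
proof
  assume le: "wpp_le (weakly_prime_pair_of G) (weakly_prime_pair_of H)"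
  have "x \<in> G \<longrightarrow> x \<in> H" for x
  proof (induction x rule: modal_lattice_induct)
  qed (use le prime_filter_bot[OF G] prime_filter_top[OF H] in
      \<open>auto simp: wpp_le_def weakly_prime_pair_of_def prime_filter_sup_iff[OF G]
        prime_filter_sup_iff[OF H] prime_filter_inf_iff[OF G] prime_filter_inf_iff[OF H]\<close>)
  then show "G \<subseteq> H" by blast
qed (auto simp: wpp_le_def weakly_prime_pair_of_def)

lemma inj_on_weakly_prime_pair_of: "inj_on weakly_prime_pair_of prime_filters"
proof (rule inj_onI)
  fix G H :: "'a modal_lattice set"
  assume GH: "G \<in> prime_filters" "H \<in> prime_filters"
    and eq: "weakly_prime_pair_of G = weakly_prime_pair_of H"
  have "wpp_le p p" for p :: "'a set \<times> 'a set"
    by (simp add: wpp_le_def case_prod_beta)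
  then show "G = H"
    using weakly_prime_pair_of_le_iff[OF GH] weakly_prime_pair_of_le_iff[OF GH(2,1)] eq by auto
qed

lemma weakly_prime_pair_of_image_generators:
  "weakly_prime_pair_of ` pplus (Box a) = box_up a"
  "weakly_prime_pair_of ` pminus (Box a) = box_down a"
  "weakly_prime_pair_of ` pplus (Dia a) = dia_up a"
  "weakly_prime_pair_of ` pminus (Dia a) = dia_down a"
  \<comment> \<open>Surjectivity enters here: once \<open>weakly_prime_pairs\<close> is rewritten as
    an image, each equation follows by evaluating the map.\<close>
  unfolding pplus_def pminus_def box_up_def box_down_def dia_up_def dia_down_def
    image_weakly_prime_pair_of[symmetric]
  by (auto simp: weakly_prime_pair_of_def)

text \<open>This is continuity of the inverse on subbasic sets. The map sends unions to unions
  always, and intersections to intersections by injectivity, so openness passes from generators to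
  all \<open>d\<close>.\<close>

lemma openin_weakly_prime_pair_of_image:
  "openin wpp_topology (weakly_prime_pair_of ` pplus d) \<and>
   openin wpp_topology (weakly_prime_pair_of ` pminus d)"
proof (induction d rule: modal_lattice_induct)
  have Int: "weakly_prime_pair_of ` (A \<inter> B) = weakly_prime_pair_of ` A \<inter> weakly_prime_pair_of ` B"
    if "A \<subseteq> prime_filters" "B \<subseteq> prime_filters" for A B :: "'a modal_lattice set set"
    using inj_on_image_Int[OF inj_on_weakly_prime_pair_of that] .
  have sub: "pplus x \<subseteq> prime_filters" "pminus x \<subseteq> prime_filters" for x :: "'a modal_lattice"
    by (auto simp: pplus_def pminus_def)
  have top: "openin wpp_topology (weakly_prime_pairs :: ('a set \<times> 'a set) set)"
    using openin_topspace[of wpp_topology] by (simp add: topspace_wpp_topology)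
  case (1 a)
  show ?case by (simp add: weakly_prime_pair_of_image_generators openin_wpp)
  case (2 a)
  show ?case by (simp add: weakly_prime_pair_of_image_generators openin_wpp)
  case 3
  show ?case by (simp add: pplus_bot pminus_bot image_weakly_prime_pair_of top)
  case 4
  show ?case by (simp add: pplus_top pminus_top image_weakly_prime_pair_of top)
  case (5 x y)
  then show ?case by (auto simp: pplus_sup pminus_sup image_Un Int sub)
  case (6 x y)
  then show ?case by (auto simp: pplus_inf pminus_inf image_Un Int sub)
qed

text \<open>For a bijection, both continuity conditions need checking only on the generating
  families.\<close>

lemma homeomorphic_map_generated_by:
  assumes inj: "inj_on f (\<Union>\<A>)"
    and image: "f ` \<Union>\<A> = \<Union>\<B>"
    and open_image: "\<And>A. A \<in> \<A> \<Longrightarrow> openin (topology_generated_by \<B>) (f ` A)"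
    and open_preimage: "\<And>B. B \<in> \<B> \<Longrightarrow> openin (topology_generated_by \<A>) (f -` B \<inter> \<Union>\<A>)"
  shows "homeomorphic_map (topology_generated_by \<A>) (topology_generated_by \<B>) f"
proof -
  let ?g = "inv_into (\<Union>\<A>) f"
  have g_mem: "?g y \<in> \<Union>\<A>" and fg: "f (?g y) = y" if "y \<in> \<Union>\<B>" for y
    using that unfolding image[symmetric] by (rule inv_into_into, rule f_inv_into_f)
  have gf: "?g (f x) = x" if "x \<in> \<Union>\<A>" for x
    using inj that by (rule inv_into_f_f)
  have cont_f: "continuous_map (topology_generated_by \<A>) (topology_generated_by \<B>) f"
    using open_preimage image
    by (intro continuous_on_generated_topo) (auto simp: topology_generated_by_topspace)
  \<comment> \<open>Preimages under the inverse are forward images, so \<open>open_image\<close>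
    gives continuity of \<open>?g\<close>.\<close>
  have "?g -` A \<inter> \<Union>\<B> = f ` A" if "A \<in> \<A>" for A
  proof
    show "?g -` A \<inter> \<Union>\<B> \<subseteq> f ` A"
      using fg by force
    show "f ` A \<subseteq> ?g -` A \<inter> \<Union>\<B>"
      unfolding image[symmetric] using gf that by auto
  qed
  then have cont_g: "continuous_map (topology_generated_by \<B>) (topology_generated_by \<A>) ?g"
    using open_image image_subsetI[of "\<Union>\<B>" ?g "\<Union>\<A>", OF g_mem]
    by (intro continuous_on_generated_topo) (simp_all add: topology_generated_by_topspace)
  show ?thesis
    unfolding homeomorphic_map_maps homeomorphic_maps_def topology_generated_by_topspace
    by (intro exI[of _ ?g] conjI ballI cont_f cont_g gf fg)
qed

text \<open>The two directions are uneven: generators of \<open>wpp_topology\<close> pull back to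
  subbasic sets, whereas \<open>pplus d\<close> and \<open>pminus d\<close> for arbitrary
  \<open>d\<close> rely on the induction above.\<close>

lemma homeomorphic_map_weakly_prime_pair_of:
  "homeomorphic_map priestley_topology wpp_topology weakly_prime_pair_of"
  unfolding priestley_topology_def wpp_topology_def
proof (rule homeomorphic_map_generated_by, fold priestley_topology_def wpp_topology_def)
  let ?W = "range box_up \<union> range box_down \<union> range dia_up \<union> range dia_down :: ('a set \<times> 'a set) set set"
  have P: "\<Union>(range pplus \<union> range pminus) = (prime_filters :: 'a modal_lattice set set)"
    using topspace_priestley_topology
    unfolding priestley_topology_def topology_generated_by_topspace .
  have W: "\<Union>?W = weakly_prime_pairs"
    using topspace_wpp_topology unfolding wpp_topology_def topology_generated_by_topspace .
  show "inj_on weakly_prime_pair_of (\<Union>(range pplus \<union> range pminus :: 'a modal_lattice set set set))"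
    unfolding P by (rule inj_on_weakly_prime_pair_of)
  show "weakly_prime_pair_of ` \<Union>(range pplus \<union> range pminus) = \<Union>?W"
    unfolding P W by (rule image_weakly_prime_pair_of)
  show "openin wpp_topology (weakly_prime_pair_of ` A)"
    if "A \<in> range pplus \<union> range pminus" for A :: "'a modal_lattice set set"
    using that openin_weakly_prime_pair_of_image by blast
  \<comment> \<open>Injectivity makes preimage undo image, so the image formulas for generators can
    be read backwards.\<close>
  have preimage: "weakly_prime_pair_of -` (weakly_prime_pair_of ` A) \<inter> prime_filters = A"
    if "A \<subseteq> prime_filters" for A :: "'a modal_lattice set set"
    using that inj_on_image_mem_iff[OF inj_on_weakly_prime_pair_of _ that] by blast
  have generators: "weakly_prime_pair_of -` box_up a \<inter> prime_filters = pplus (Box a)"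
    "weakly_prime_pair_of -` box_down a \<inter> prime_filters = pminus (Box a)"
    "weakly_prime_pair_of -` dia_up a \<inter> prime_filters = pplus (Dia a)"
    "weakly_prime_pair_of -` dia_down a \<inter> prime_filters = pminus (Dia a)" for a :: 'a
    unfolding weakly_prime_pair_of_image_generators[symmetric]
    by (rule preimage, force simp: pplus_def pminus_def)+
  show "openin priestley_topology (weakly_prime_pair_of -` B \<inter> \<Union>(range pplus \<union> range pminus))"
    if "B \<in> ?W" for B
    using that unfolding P by (auto simp: generators openin_pplus openin_pminus)
qed

theorem proposition4p15:
  shows "\<exists>\<Lambda> :: 'a::{bounded_lattice,distrib_lattice} modal_lattice set \<Rightarrow> 'a set \<times> 'a set.
    order_homeomorphism priestley_topology (\<subseteq>) wpp_topology wpp_le \<Lambda> \<and>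
    (\<forall>G\<in>prime_filters. \<Lambda> G = ({a. Box a \<in> G}, {a. Dia a \<notin> G})) \<and>
    (\<forall>a. \<Lambda> ` pplus (Box a) = box_up a \<and> \<Lambda> ` pminus (Box a) = box_down a \<and>
         \<Lambda> ` pplus (Dia a) = dia_up a \<and> \<Lambda> ` pminus (Dia a) = dia_down a)"
proof (intro exI conjI ballI allI)
  \<comment> \<open>This goal fixes the witness \<open>weakly_prime_pair_of\<close>; the remaining
    conjuncts are its definition and the image formulas.\<close>
  show "order_homeomorphism priestley_topology (\<subseteq>) wpp_topology wpp_le
      (weakly_prime_pair_of :: 'a modal_lattice set \<Rightarrow> _)"
    unfolding order_homeomorphism_def order_isomorphism_on_def bij_betw_def
    by (simp add: topspace_priestley_topology topspace_wpp_topology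
        homeomorphic_map_weakly_prime_pair_of inj_on_weakly_prime_pair_of
        image_weakly_prime_pair_of weakly_prime_pair_of_le_iff)
qed (rule weakly_prime_pair_of_def weakly_prime_pair_of_image_generators)+

end
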